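(* Let $n\ge 2$ be an integer and let $G$ be a connected graph on $n$ vertices. Then $\eta_{per}(G)=0$ if and only if one of the following holds: (i) $G$ has a perfect matching, or (ii) $G[D(G)]$ has no isolated vertices, or (iii) $G[D(G)]$ has isolated vertices and $G$ has a maximum matching covering every isolated vertex of $G[D(G)]$.
   Context: All graphs are finite and simple. For a graph $G$ with $n$ vertices and adjacency matrix $A(G)$, the permanental polynomial is $\pi(G,x)=\mathrm{per}(xI-A(G))$, where $\mathrm{per}(A)=\sum_{\sigma}\prod_{i=1}^n a_{i\sigma(i)}$ with $\sigma$ ranging over all permutations of $\{1,\dots,n\}$. The permanental nullity $\eta_{per}(G)$ is the multiplicity of $0$ as a root of $\pi(G,x)$ (it is $0$ if $0$ is not a root). A vertex is covered by a matching if some edge of the matching is incident with it; a perfect matching covers all vertices; a maximum matching is one covering as many vertices as possible. $D(G)$ is the set of all vertices of $G$ that are left uncovered by at least one maximum matching of $G$, and $G[D(G)]$ is the subgraph induced by $D(G)$. *)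

theory Defs
  imports
    "Graph_Theory.Graph_Theory"
    "HOL-Combinatorics.Permutations"
    "HOL-Computational_Algebra.Polynomial"
begin

text \<open>A finite simple graph is a \<^const>\<open>pair_graph\<close>: a finite, loopfree, symmetric set of
  arcs without parallel arcs. The undirected edge \<open>uv\<close> is the pair of arcs \<open>(u, v)\<close>, \<open>(v, u)\<close>;
  it is turned into the two-element set \<open>{u, v}\<close> when matchings are formed.

  Matrices are functions of two indices from an explicit index set \<open>I\<close>. For the matrices of a
  graph, \<open>I\<close> is its vertex set, so that no enumeration of the vertices has to be chosen; the
  permanent does not depend on one.\<close>

definition permanent :: "'i set \<Rightarrow> ('i \<Rightarrow> 'i \<Rightarrow> 'r) \<Rightarrow> 'r::comm_semiring_1"
  where "permanent I A = (\<Sum>\<sigma> | \<sigma> permutes I. \<Prod>i\<in>I. A i (\<sigma> i))"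

definition adjacency_matrix :: "'a pair_pre_digraph \<Rightarrow> 'a \<Rightarrow> 'a \<Rightarrow> real"
  where "adjacency_matrix G u v = (if (u, v) \<in> parcs G then 1 else 0)"

definition permanental_poly :: "'a pair_pre_digraph \<Rightarrow> real poly"
  where "permanental_poly G =
    permanent (pverts G)
      (\<lambda>u v. (if u = v then [:0, 1:] else 0) - [:adjacency_matrix G u v:])"

text \<open>\<^const>\<open>order\<close> is only meaningful for nonzero polynomials; the lemma
  \<open>permanental_poly_monic\<close> below shows that this is the case here.\<close>

definition permanental_nullity :: "'a pair_pre_digraph \<Rightarrow> nat"
  where "permanental_nullity G = order 0 (permanental_poly G)"

definition edges :: "'a pair_pre_digraph \<Rightarrow> 'a set set"
  where "edges G = {{u, v} |u v. (u, v) \<in> parcs G}"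

definition matching :: "'a pair_pre_digraph \<Rightarrow> 'a set set \<Rightarrow> bool"
  where "matching G M \<longleftrightarrow> M \<subseteq> edges G \<and> (\<forall>e\<in>M. \<forall>f\<in>M. e \<noteq> f \<longrightarrow> e \<inter> f = {})"

definition covered :: "'a set set \<Rightarrow> 'a set"
  where "covered M = {v. \<exists>e\<in>M. v \<in> e}"

definition perfect_matching :: "'a pair_pre_digraph \<Rightarrow> 'a set set \<Rightarrow> bool"
  where "perfect_matching G M \<longleftrightarrow> matching G M \<and> pverts G \<subseteq> covered M"

definition maximum_matching :: "'a pair_pre_digraph \<Rightarrow> 'a set set \<Rightarrow> bool"
  where "maximum_matching G M \<longleftrightarrow>
    matching G M \<and> (\<forall>N. matching G N \<longrightarrow> card (covered N) \<le> card (covered M))"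

definition D_set :: "'a pair_pre_digraph \<Rightarrow> 'a set"
  where "D_set G = {v \<in> pverts G. \<exists>M. maximum_matching G M \<and> v \<notin> covered M}"

definition isolated_verts :: "('a, 'b) pre_digraph \<Rightarrow> 'a set"
  where "isolated_verts H = {v \<in> verts H. in_arcs H v = {} \<and> out_arcs H v = {}}"

lemma permanental_poly_monic:
  assumes "pair_graph G"
  shows "degree (permanental_poly G) = card (pverts G)"
    and "lead_coeff (permanental_poly G) = 1"
proof -
  interpret pair_graph G by fact
  let ?V = "pverts G"
  let ?n = "card ?V"
  let ?q = "\<lambda>u v. (if u = v then [:0, 1:] else 0) - [:adjacency_matrix G u v:] :: real poly"
  let ?P = "{\<sigma>. \<sigma> permutes ?V}"
  have fin: "finite ?V" by (rule pair_finite_verts)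
  have diag: "?q u u = [:0, 1:]" for u
    using no_loops'[of u u] by (auto simp: adjacency_matrix_def)
  have off: "degree (?q u v) \<le> of_bool (u = v)" for u v
    using diag[of u] by (cases "u = v") auto
  have small: "coeff (\<Prod>u\<in>?V. ?q u (\<sigma> u)) k = 0"
    if \<sigma>: "\<sigma> \<in> ?P - {id}" and k: "?n \<le> k" for \<sigma> k
  proof -
    obtain w where w: "\<sigma> w \<noteq> w" using \<sigma> by (auto simp: fun_eq_iff)
    then have wV: "w \<in> ?V" using \<sigma> by (auto dest: permutes_not_in)
    have "degree (\<Prod>u\<in>?V. ?q u (\<sigma> u)) \<le> (\<Sum>u\<in>?V. degree (?q u (\<sigma> u)))"
      using degree_prod_sum_le[OF fin, of "\<lambda>u. ?q u (\<sigma> u)"] by (simp add: o_def)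
    also have "\<dots> \<le> (\<Sum>u\<in>?V. of_bool (u = \<sigma> u))" by (intro sum_mono off)
    also have "\<dots> < (\<Sum>u\<in>?V. 1)"
      by (rule sum_strict_mono_ex1) (use fin w wV in \<open>auto intro!: bexI[of _ w]\<close>)
    finally show ?thesis using k by (intro coeff_eq_0) simp
  qed
  have finP: "finite ?P" using fin by (rule finite_permutations)
  have "permanental_poly G = (\<Prod>u\<in>?V. ?q u (id u)) + (\<Sum>\<sigma>\<in>?P - {id}. \<Prod>u\<in>?V. ?q u (\<sigma> u))"
    unfolding permanental_poly_def permanent_def
    by (rule sum.remove[OF finP]) (use permutes_id in blast)
  also have "(\<Prod>u\<in>?V. ?q u (id u)) = (\<Prod>u\<in>?V. [:0, 1:])"
    by (intro prod.cong refl) (use diag in simp)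
  also have "\<dots> = monom 1 ?n" by (simp add: monom_altdef)
  finally have coeff: "coeff (permanental_poly G) k = (if k = ?n then 1 else 0)"
    if "?n \<le> k" for k
    using small that by (auto simp: coeff_sum id_def intro!: sum.neutral)
  show deg: "degree (permanental_poly G) = ?n"
    by (intro antisym degree_le le_degree) (use coeff in auto)
  show "lead_coeff (permanental_poly G) = 1"
    using coeff by (simp add: deg)
qed

end

theory Submission
  imports Defs
begin

text \<open>Write \<open>I\<close> for the set of isolated vertices of the subgraph induced by \<open>D\<close>. The disjunction of (i) to
  (iii) says that some maximum matching covers \<open>I\<close>: a perfect matching covers
  everything, and if \<open>I\<close> is empty, any maximum matching will do. On the other side, the constant term of
  the permanental polynomial counts, up to sign, the permutations \<open>\<sigma>\<close> of the vertices with
  \<open>v\<close> adjacent to \<open>\<sigma> v\<close> for all \<open>v\<close> (lemma \<open>permanental_nullity_eq_0_iff\<close>). The claim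
  is thus that such a \<open>\<sigma>\<close> exists if and only if some maximum matching covers \<open>I\<close>.

  Given \<open>\<sigma>\<close>, the edges joining each \<open>v\<close> in \<open>I\<close> to \<open>\<sigma> v\<close> form a matching, since \<open>\<sigma> v\<close>
  lies outside \<open>D\<close>. A maximum matching agreeing with it as far as possible covers \<open>I\<close>, because
  otherwise one edge could be exchanged to improve the agreement
  (lemma \<open>maximum_matching_covering_isolated\<close>).

  Conversely, by Hall's theorem a permutation \<open>\<sigma>\<close> exists unless some set of vertices has fewer
  neighbours than elements. The key point is that a minimal such set \<open>T\<close> is contained in \<open>I\<close>
  (lemma \<open>minimal_violator_isolated\<close>). A matching that covers \<open>I\<close> then covers \<open>T\<close>, and sending each
  vertex of \<open>T\<close> to its partner is an injection into the neighbourhood of \<open>T\<close>, which is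
  impossible (lemma \<open>permutation_along_arcs\<close>). The neighbourhood of a set \<open>S\<close> of
  vertices is written as the relational image \<open>parcs G `` S\<close>.\<close>

section \<open>Systems of distinct representatives\<close>

text \<open>Hall's theorem, by the argument of Halmos and Vaughan. If every nonempty proper subfamily has
  a surplus, then any choice at one index leaves Hall's condition intact for the rest. Otherwise
  some nonempty proper subfamily \<open>J\<close> is tight; it and the family outside it, with the
  elements used by \<open>J\<close> removed, both satisfy Hall's condition.\<close>

lemma hall_marriage:
  fixes A :: "'i \<Rightarrow> 'b set"
  assumes "finite I" "\<And>i. i \<in> I \<Longrightarrow> finite (A i)"
    and "\<And>J. J \<subseteq> I \<Longrightarrow> card J \<le> card (\<Union>(A ` J))"
  shows "\<exists>f. inj_on f I \<and> (\<forall>i\<in>I. f i \<in> A i)"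
  using assms
proof (induction I arbitrary: A rule: finite_psubset_induct)
  case (psubset I)
  have fin: "finite (\<Union>(A ` J))" if "J \<subseteq> I" for J
    using that psubset.hyps psubset.prems(1) by (auto intro: finite_subset)
  have finJ: "finite J" if "J \<subseteq> I" for J
    using that psubset.hyps finite_subset by blast
  consider "I = {}"
    | (tight) J where "J \<noteq> {}" "J \<subset> I" "card (\<Union>(A ` J)) = card J"
    | (loose) "I \<noteq> {}" "\<And>J. J \<noteq> {} \<Longrightarrow> J \<subset> I \<Longrightarrow> card J < card (\<Union>(A ` J))"
    using psubset.prems(2) by (metis order.not_eq_order_implies_strict psubset_imp_subset)
  then show ?case
  proof cases
    case 1
    then show ?thesis by simp
  next
    case tight
    let ?U = "\<Union>(A ` J)"
    have JI: "J \<subseteq> I" and JC: "I - J \<subset> I" using tight by auto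
    obtain f where f: "inj_on f J" "\<forall>i\<in>J. f i \<in> A i"
    proof -
      have "\<exists>f. inj_on f J \<and> (\<forall>i\<in>J. f i \<in> A i)"
        by (rule psubset.IH[OF tight(2)]) (use psubset.prems JI in \<open>auto dest: subset_trans\<close>)
      then show ?thesis using that by blast
    qed
    have outer: "card K \<le> card (\<Union>i\<in>K. A i - ?U)" if K: "K \<subseteq> I - J" for K
    proof -
      have KI: "J \<union> K \<subseteq> I" using K JI by auto
      have "card J + card K = card (J \<union> K)"
        using K KI finJ by (subst card_Un_disjoint) auto
      also have "\<dots> \<le> card (\<Union>(A ` (J \<union> K)))" by (rule psubset.prems(2)[OF KI])
      also have "\<Union>(A ` (J \<union> K)) = ?U \<union> (\<Union>i\<in>K. A i - ?U)" by auto
      also have "card \<dots> \<le> card J + card (\<Union>i\<in>K. A i - ?U)"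
        using card_Un_le tight(3) by metis
      finally show ?thesis by simp
    qed
    have "\<exists>g. inj_on g (I - J) \<and> (\<forall>i\<in>I - J. g i \<in> A i - ?U)"
    proof (rule psubset.IH[OF JC])
      show "finite (A i - ?U)" if "i \<in> I - J" for i using that psubset.prems(1) by blast
    qed (rule outer)
    then obtain g where g: "inj_on g (I - J)" "\<forall>i\<in>I - J. g i \<in> A i - ?U" by blast
    let ?h = "\<lambda>i. if i \<in> J then f i else g i"
    have "f ` J \<subseteq> ?U" "g ` (I - J) \<inter> ?U = {}" using f(2) g(2) by fast+
    then have "f ` J \<inter> g ` (I - J) = {}" by (metis inf_commute disjoint_iff subsetD)
    then have "inj_on ?h (J \<union> (I - J))" using f(1) g(1) by (intro inj_on_disjoint_Un) auto
    then have "inj_on ?h I" using JI by (simp add: Un_absorb1)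
    then show ?thesis using f g by (intro exI[of _ ?h]) auto
  next
    case loose
    then obtain i where i: "i \<in> I" by auto
    have "card {i} \<le> card (\<Union>(A ` {i}))" using i by (intro psubset.prems(2)) auto
    then obtain x where x: "x \<in> A i" by fastforce
    have "card K \<le> card (\<Union>j\<in>K. A j - {x})" if K: "K \<subseteq> I - {i}" for K
    proof (cases "K = {}")
      case False
      then have "card K < card (\<Union>(A ` K))" using K i by (intro loose) auto
      moreover have "(\<Union>j\<in>K. A j - {x}) = \<Union>(A ` K) - {x}" by auto
      ultimately show ?thesis by (auto simp: card_Diff_singleton_if)
    qed simp
    then obtain g where g: "inj_on g (I - {i})" "\<forall>j\<in>I - {i}. g j \<in> A j - {x}"
      using psubset.IH[of "I - {i}" "\<lambda>j. A j - {x}"] psubset.prems(1) i by auto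
    have "inj_on (g(i := x)) I"
      using g unfolding inj_on_def by (metis DiffD2 DiffI fun_upd_apply singletonD singletonI)
    moreover have "\<forall>j\<in>I. (g(i := x)) j \<in> A j" using g(2) x by auto
    ultimately show ?thesis by blast
  qed
qed

section \<open>The permanent at zero\<close>

text \<open>Up to the sign \<open>(-1)^n\<close>, the constant term of the permanental polynomial is the permanent of a
  0-1 matrix. No cancellation can occur there, so it counts the permutations that move every vertex
  along an arc.\<close>

lemma (in pair_graph) permanental_nullity_eq_0_iff:
  "permanental_nullity G = 0 \<longleftrightarrow>
    (\<exists>\<sigma>. \<sigma> permutes pverts G \<and> (\<forall>v\<in>pverts G. (v, \<sigma> v) \<in> parcs G))"
proof -
  let ?V = "pverts G"
  let ?P = "{\<sigma>. \<sigma> permutes ?V}"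
  have fin: "finite ?V" by (rule pair_finite_verts)
  have "poly (permanental_poly G) 0 = (\<Sum>\<sigma>\<in>?P. \<Prod>v\<in>?V. - adjacency_matrix G v (\<sigma> v))"
    unfolding permanental_poly_def permanent_def poly_sum poly_prod
    by (intro sum.cong prod.cong) auto
  also have "\<dots> = (-1) ^ card ?V * (\<Sum>\<sigma>\<in>?P. \<Prod>v\<in>?V. adjacency_matrix G v (\<sigma> v))"
    by (simp add: prod_uminus sum_distrib_left)
  finally have "poly (permanental_poly G) 0 = 0 \<longleftrightarrow>
      (\<Sum>\<sigma>\<in>?P. \<Prod>v\<in>?V. adjacency_matrix G v (\<sigma> v)) = 0"
    by simp
  also have "\<dots> \<longleftrightarrow> (\<forall>\<sigma>\<in>?P. (\<Prod>v\<in>?V. adjacency_matrix G v (\<sigma> v)) = 0)"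
    by (intro sum_nonneg_eq_0_iff finite_permutations fin prod_nonneg ballI)
      (simp add: adjacency_matrix_def)
  also have "\<dots> \<longleftrightarrow> \<not> (\<exists>\<sigma>. \<sigma> permutes ?V \<and> (\<forall>v\<in>?V. (v, \<sigma> v) \<in> parcs G))"
    using fin by (auto simp: adjacency_matrix_def)
  finally have root: "poly (permanental_poly G) 0 = 0 \<longleftrightarrow>
      \<not> (\<exists>\<sigma>. \<sigma> permutes ?V \<and> (\<forall>v\<in>?V. (v, \<sigma> v) \<in> parcs G))" .
  have "permanental_poly G \<noteq> 0"
    using permanental_poly_monic(2)[OF pair_graph_axioms] by auto
  then show ?thesis
    unfolding permanental_nullity_def using root order_root[of "permanental_poly G" 0] by blast
qed

section \<open>Matchings\<close>

context pair_graph
begin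

lemma edge_iff_arc: "{u, v} \<in> edges G \<longleftrightarrow> (u, v) \<in> parcs G"
  unfolding edges_def using arcs_symmetric by (auto simp: doubleton_eq_iff)

lemma edge_cases:
  assumes "e \<in> edges G" "u \<in> e"
  obtains v where "e = {u, v}" "v \<noteq> u" "(u, v) \<in> parcs G"
proof -
  obtain a b where ab: "e = {a, b}" "(a, b) \<in> parcs G"
    using assms(1) by (auto simp: edges_def)
  moreover have "a \<noteq> b" "(b, a) \<in> parcs G"
    using ab no_loops' arcs_symmetric by auto
  ultimately show ?thesis using that assms(2) by (cases "u = a") auto
qed

lemma matching_subset: "matching G M \<Longrightarrow> N \<subseteq> M \<Longrightarrow> matching G N"
  unfolding matching_def by blast

lemma matching_Un:
  assumes "matching G M" "matching G N" and "\<And>e f. e \<in> M \<Longrightarrow> f \<in> N \<Longrightarrow> e \<inter> f = {}"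
  shows "matching G (M \<union> N)"
  using assms unfolding matching_def by (metis (no_types) Un_iff Un_subset_iff Int_commute)

lemma matching_edge_unique:
  assumes "matching G M" "e \<in> M" "f \<in> M" "x \<in> e" "x \<in> f"
  shows "e = f"
  using assms unfolding matching_def by blast

lemma covered_edge:
  assumes "matching G M" "u \<in> covered M"
  obtains v where "{u, v} \<in> M"
proof -
  obtain e where e: "e \<in> M" "u \<in> e" using assms(2) by (auto simp: covered_def)
  then have "e \<in> edges G" using assms(1) by (auto simp: matching_def)
  then show ?thesis using e that by (metis edge_cases)
qed

lemma covered_subset_verts: "matching G M \<Longrightarrow> covered M \<subseteq> pverts G"
  using in_arcsD1 in_arcsD2 by (fastforce simp: matching_def covered_def edges_def)

lemma finite_matching:
  assumes "matching G M" shows "finite M"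
proof (rule finite_subset)
  show "M \<subseteq> Pow (pverts G)"
    using covered_subset_verts[OF assms] by (auto simp: covered_def)
qed (simp add: pair_finite_verts)

lemma card_covered:
  assumes "matching G M"
  shows "card (covered M) = 2 * card M"
proof -
  have two: "card e = 2" if "e \<in> M" for e
  proof -
    have "e \<in> edges G" using that assms by (auto simp: matching_def)
    then obtain u v where "e = {u, v}" "(u, v) \<in> parcs G" by (auto simp: edges_def)
    then show ?thesis using no_loops' by auto
  qed
  have "covered M = \<Union>M" by (auto simp: covered_def)
  moreover have "card (\<Union>M) = (\<Sum>e\<in>M. card e)"
    using assms two
    by (intro card_Union_disjoint) (auto simp: matching_def disjoint_def intro: card_ge_0_finite)
  ultimately show ?thesis using two by simp
qed

lemma maximum_matching_iff_card:
  "maximum_matching G M \<longleftrightarrow> matching G M \<and> (\<forall>N. matching G N \<longrightarrow> card N \<le> card M)"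
  unfolding maximum_matching_def using card_covered by fastforce

text \<open>Maximising a bounded quantity over the maximum matchings; a constant quantity yields the mere
  existence of a maximum matching.\<close>

lemma ex_maximum_matching_maximising:
  fixes F :: "'a set set \<Rightarrow> nat"
  assumes "\<And>M. matching G M \<Longrightarrow> F M \<le> b"
  obtains M where "maximum_matching G M" "\<And>N. maximum_matching G N \<Longrightarrow> F N \<le> F M"
proof -
  have "card M \<le> card (pverts G)" if "matching G M" for M
    using card_mono[OF pair_finite_verts covered_subset_verts[OF that]] card_covered[OF that]
    by simp
  moreover have "matching G {}" by (simp add: matching_def)
  ultimately have "\<exists>M. maximum_matching G M"
    using ex_has_greatest_nat[of "matching G" "{}" card "Suc (card (pverts G))"]
    unfolding maximum_matching_iff_card by (auto simp: less_Suc_eq_le)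
  then obtain M0 where M0: "maximum_matching G M0" by blast
  have "\<exists>M. maximum_matching G M \<and> (\<forall>N. maximum_matching G N \<longrightarrow> F N \<le> F M)"
    using M0 assms
    by (intro ex_has_greatest_nat[where k = M0 and b = "Suc b"])
      (auto simp: maximum_matching_def less_Suc_eq_le)
  then show ?thesis using that by blast
qed

text \<open>Trading the edge \<open>uw\<close> for \<open>uv\<close> uncovers \<open>w\<close> in place of \<open>v\<close> and keeps the size.\<close>

lemma matching_exchange:
  assumes M: "maximum_matching G M" and uw: "{u, w} \<in> M"
    and v: "v \<notin> covered M" and uv: "(u, v) \<in> parcs G"
  shows "maximum_matching G (insert {u, v} (M - {{u, w}}))"
proof -
  have mM: "matching G M" using M by (simp add: maximum_matching_def)
  have "u \<notin> e \<and> v \<notin> e" if "e \<in> M - {{u, w}}" for e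
    using that v uw matching_edge_unique[OF mM, of e "{u, w}" u] by (auto simp: covered_def)
  then have "matching G (insert {u, v} (M - {{u, w}}))"
    using mM uv unfolding matching_def by (auto simp: edge_iff_arc)
  moreover have "card (insert {u, v} (M - {{u, w}})) = card M"
  proof -
    have "{u, v} \<notin> M" using v by (auto simp: covered_def)
    then show ?thesis using finite_matching[OF mM] uw
      by (metis DiffD1 card_Suc_Diff1 card_insert_disjoint finite_Diff)
  qed
  ultimately show ?thesis using M by (simp add: maximum_matching_iff_card)
qed

lemma matching_of_injection:
  assumes inj: "inj_on f S" and arc: "\<And>s. s \<in> S \<Longrightarrow> (s, f s) \<in> parcs G" and disj: "f ` S \<inter> S = {}"
  shows "matching G ((\<lambda>s. {s, f s}) ` S)" and "card ((\<lambda>s. {s, f s}) ` S) = card S"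
proof -
  have off: "f s \<noteq> t" if "s \<in> S" "t \<in> S" for s t using that disj by auto
  show "matching G ((\<lambda>s. {s, f s}) ` S)"
    unfolding matching_def using arc inj off by (auto simp: edge_iff_arc inj_on_def) (metis off)+
  have "inj_on (\<lambda>s. {s, f s}) S"
    using off by (auto intro!: inj_onI simp: doubleton_eq_iff)
  then show "card ((\<lambda>s. {s, f s}) ` S) = card S" by (rule card_image)
qed

section \<open>From a permutation to a matching: isolated vertices of the subgraph induced by D\<close>

lemma isolated_verts_D_iff:
  "v \<in> isolated_verts (with_proj G \<restriction> D_set G) \<longleftrightarrow>
    v \<in> D_set G \<and> (\<forall>u. (v, u) \<in> parcs G \<longrightarrow> u \<notin> D_set G)"
  using arcs_symmetric
  by (auto simp: isolated_verts_def in_arcs_def out_arcs_def induce_subgraph_def)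

lemma isolated_verts_D_subset: "isolated_verts (with_proj G \<restriction> D_set G) \<subseteq> pverts G"
proof -
  have "D_set G \<subseteq> pverts G" by (auto simp: D_set_def)
  then show ?thesis by (auto simp: isolated_verts_D_iff)
qed

text \<open>A permutation along arcs provides a matching \<open>N\<close> covering the isolated vertices, because the
  neighbours of these vertices lie outside \<open>D\<close>. Choose a maximum matching that shares as many edges
  as possible with \<open>N\<close>. If it missed an isolated vertex \<open>v\<close>, it could be rerouted at \<open>\<sigma> v\<close>,
  which every maximum matching covers: this gains an edge of \<open>N\<close> and loses none.\<close>

lemma maximum_matching_covering_isolated:
  assumes \<sigma>: "\<sigma> permutes pverts G" and arc: "\<And>v. v \<in> pverts G \<Longrightarrow> (v, \<sigma> v) \<in> parcs G"
  shows "\<exists>M. maximum_matching G M \<and> isolated_verts (with_proj G \<restriction> D_set G) \<subseteq> covered M"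
proof -
  let ?I = "isolated_verts (with_proj G \<restriction> D_set G)"
  define N where "N = (\<lambda>v. {v, \<sigma> v}) ` ?I"
  have IV: "?I \<subseteq> pverts G" by (rule isolated_verts_D_subset)
  have outside: "\<sigma> v \<notin> D_set G" if "v \<in> ?I" for v
    using that arc[of v] subsetD[OF IV that] isolated_verts_D_iff by blast
  have N: "matching G N"
    unfolding N_def
  proof (rule matching_of_injection)
    show "inj_on \<sigma> ?I" by (rule permutes_inj_on[OF \<sigma>])
    show "(v, \<sigma> v) \<in> parcs G" if "v \<in> ?I" for v using that arc IV by blast
    show "\<sigma> ` ?I \<inter> ?I = {}" using outside isolated_verts_D_iff by blast
  qed
  have "card (M \<inter> N) \<le> card N" for M
    by (intro card_mono finite_matching[OF N]) auto
  then obtain M where M: "maximum_matching G M"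
    and best: "\<And>M'. maximum_matching G M' \<Longrightarrow> card (M' \<inter> N) \<le> card (M \<inter> N)"
    using ex_maximum_matching_maximising[of "\<lambda>M. card (M \<inter> N)" "card N"] by metis
  have mM: "matching G M" using M by (simp add: maximum_matching_def)
  have "v \<in> covered M" if v: "v \<in> ?I" for v
  proof (rule ccontr)
    assume unc: "v \<notin> covered M"
    let ?u = "\<sigma> v"
    have vu: "(v, ?u) \<in> parcs G" using v IV arc by auto
    have uv: "(?u, v) \<in> parcs G" using vu arcs_symmetric by blast
    have "?u \<in> covered M"
      using outside[OF v] M in_arcsD2[OF vu] by (auto simp: D_set_def)
    then obtain w where w: "{?u, w} \<in> M"
      using covered_edge[OF mM] by blast
    have uvN: "{?u, v} \<in> N" using v by (auto simp: N_def insert_commute)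
    have uvM: "{?u, v} \<notin> M" using unc by (auto simp: covered_def)
    have uwN: "{?u, w} \<notin> N"
      using matching_edge_unique[OF N _ uvN, of "{?u, w}" ?u] w uvM by auto
    \<comment> \<open>The discarded edge is not in \<open>N\<close>, because there \<open>\<sigma> v\<close> is already matched to \<open>v\<close>.\<close>
    let ?M = "insert {?u, v} (M - {{?u, w}})"
    have "?M \<inter> N = insert {?u, v} (M \<inter> N)" using uvN uwN by auto
    then have "card (?M \<inter> N) = Suc (card (M \<inter> N))"
      using uvM finite_matching[OF mM] by simp
    then show False using best[OF matching_exchange[OF M w unc uv]] by simp
  qed
  then show ?thesis using M by blast
qed

section \<open>From a matching to a permutation: minimal violators of Hall's condition\<close>

text \<open>A minimal set \<open>T\<close> with fewer neighbours than elements is a set of isolated vertices of the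
  subgraph induced by \<open>D\<close>. By minimality \<open>T\<close> is independent, and for each \<open>t\<close> in \<open>T\<close> the vertices of
  \<open>T - {t}\<close> can be matched onto all neighbours of \<open>T\<close>. In any maximum matching, the edges that meet
  the neighbourhood of \<open>T\<close> may be replaced by this matching without loss. Hence
  \<open>t\<close> is missed by some maximum matching, while every maximum matching covers the neighbourhood of
  \<open>T\<close>, as otherwise the replacement would gain an edge.\<close>

lemma minimal_violator_isolated:
  assumes TV: "T \<subseteq> pverts G" and viol: "card (parcs G `` T) < card T"
    and minimal: "\<And>S. S \<subset> T \<Longrightarrow> card S \<le> card (parcs G `` S)"
  shows "T \<subseteq> isolated_verts (with_proj G \<restriction> D_set G)"
proof -
  let ?N = "parcs G `` T"
  have finT: "finite T" using TV pair_finite_verts finite_subset by blast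
  have NV: "parcs G `` S \<subseteq> pverts G" for S by (auto dest: in_arcsD2)
  have finN: "finite (parcs G `` S)" for S using NV pair_finite_verts finite_subset by blast
  have indep: "T \<inter> ?N = {}"
  proof (rule ccontr)
    assume meet: "T \<inter> ?N \<noteq> {}"
    \<comment> \<open>The vertices of \<open>T\<close> without a neighbour in \<open>T\<close> violate Hall's condition as well: passing to
      them removes \<open>T \<inter> ?N\<close> from the set and from its neighbourhood.\<close>
    have "parcs G `` (T - ?N) \<subseteq> ?N - T" using arcs_symmetric by blast
    then have "card (parcs G `` (T - ?N)) \<le> card (?N - T)" using finN by (intro card_mono) auto
    moreover have "card (T - ?N) \<le> card (parcs G `` (T - ?N))" using meet by (intro minimal) auto
    moreover have "card (?N - T) < card (T - ?N)"
      using viol finT finN card_Int_Diff[of T ?N] card_Int_Diff[of ?N T]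
      by (simp add: Int_commute)
    ultimately show False by simp
  qed
  have replace: "\<exists>M'. matching G M' \<and> t \<notin> covered M' \<and>
      card M + card (?N - covered M) \<le> card M'" if M: "matching G M" and t: "t \<in> T" for M t
  proof -
    have hall: "card J \<le> card (\<Union>s\<in>J. parcs G `` {s})" if "J \<subseteq> T - {t}" for J
    proof -
      have "(\<Union>s\<in>J. parcs G `` {s}) = parcs G `` J" by auto
      then show ?thesis using minimal[of J] that t by auto
    qed
    obtain f where f: "inj_on f (T - {t})" "\<forall>s\<in>T - {t}. f s \<in> parcs G `` {s}"
      using hall_marriage[of "T - {t}" "\<lambda>s. parcs G `` {s}", OF _ _ hall] finT finN by auto
    have fN: "f ` (T - {t}) \<subseteq> ?N" using f by auto
    \<comment> \<open>As \<open>T\<close> is a violator, \<open>K\<close> still has at least \<open>card ?N\<close> edges, whereas at most one edge of \<open>M\<close>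
      is discarded for each vertex of \<open>?N\<close>.\<close>
    define K where "K = (\<lambda>s. {s, f s}) ` (T - {t})"
    define L where "L = {e \<in> M. e \<inter> ?N = {}}"
    have K: "matching G K" "card K = card (T - {t})"
      unfolding K_def by (rule matching_of_injection; use f fN indep in auto)+
    have L: "matching G L" using matching_subset[OF M] by (auto simp: L_def)
    have LT: "e \<inter> T = {}" if "e \<in> L" for e
    proof (rule ccontr)
      assume "e \<inter> T \<noteq> {}"
      then obtain s where s: "s \<in> e" "s \<in> T" by auto
      have "e \<in> edges G" using that M by (auto simp: L_def matching_def)
      then obtain x where "e = {s, x}" "(s, x) \<in> parcs G" using s(1) by (rule edge_cases)
      then show False using that s by (auto simp: L_def)
    qed
    have KTN: "e \<subseteq> (T - {t}) \<union> ?N" if "e \<in> K" for e using that fN by (auto simp: K_def)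
    have apart: "e \<inter> e' = {}" if "e \<in> L" "e' \<in> K" for e e'
      using LT[OF that(1)] KTN[OF that(2)] that(1) by (auto simp: L_def)
    have KL: "matching G (K \<union> L)"
      using K(1) L apart by (intro matching_Un) auto
    have "t \<notin> covered (K \<union> L)"
      using t indep LT KTN unfolding covered_def by blast
    moreover have "card M + card (?N - covered M) \<le> card (K \<union> L)"
    proof -
      \<comment> \<open>Sending each covered vertex to its edge shows that at most \<open>card (?N \<inter> covered M)\<close> edges
        of \<open>M\<close> are discarded.\<close>
      have "M - L \<subseteq> (\<lambda>x. THE e. e \<in> M \<and> x \<in> e) ` (?N \<inter> covered M)"
      proof
        fix e assume e: "e \<in> M - L"
        then obtain x where x: "x \<in> e" "x \<in> ?N" by (auto simp: L_def)
        have "(THE e. e \<in> M \<and> x \<in> e) = e"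
          using e x matching_edge_unique[OF M] by (intro the_equality) auto
        then show "e \<in> (\<lambda>x. THE e. e \<in> M \<and> x \<in> e) ` (?N \<inter> covered M)"
          using e x by (intro image_eqI[of _ _ x]) (auto simp: covered_def)
      qed
      then have "card (M - L) \<le> card (?N \<inter> covered M)"
        using finN by (meson surj_card_le finite_Int)
      moreover have "card M = card L + card (M - L)"
        using finite_matching[OF M] by (simp add: L_def card_Diff_subset card_mono)
      moreover have "card ?N = card (?N \<inter> covered M) + card (?N - covered M)"
        using finN by (rule card_Int_Diff)
      moreover have "card ?N \<le> card K" using viol K(2) t finT by simp
      moreover have "card (K \<union> L) = card K + card L"
      proof (rule card_Un_disjoint)
        have "{} \<notin> K" by (auto simp: K_def)
        then show "K \<inter> L = {}" using apart by (metis Int_absorb disjoint_iff)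
      qed (use K L finite_matching in auto)
      ultimately show ?thesis by simp
    qed
    ultimately show ?thesis using KL by blast
  qed
  have inD: "t \<in> D_set G" if t: "t \<in> T" for t
  proof -
    obtain M where M: "maximum_matching G M"
      using ex_maximum_matching_maximising[of "\<lambda>_. 0" 0] by auto
    then obtain M' where "matching G M'" "t \<notin> covered M'" "card M \<le> card M'"
      using replace[of M t] t by (auto simp: maximum_matching_def)
    moreover from this have "maximum_matching G M'"
      using M by (auto simp: maximum_matching_iff_card intro: order_trans)
    ultimately show ?thesis using t TV by (auto simp: D_set_def)
  qed
  have notD: "u \<notin> D_set G" if u: "u \<in> ?N" for u
  proof
    assume "u \<in> D_set G"
    then obtain M where M: "maximum_matching G M" "u \<notin> covered M" by (auto simp: D_set_def)
    obtain t where "t \<in> T" using u by auto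
    then obtain M' where "matching G M'" "card M + card (?N - covered M) \<le> card M'"
      using replace[of M t] M by (auto simp: maximum_matching_def)
    moreover have "card (?N - covered M) > 0" using u M(2) finN by (auto simp: card_gt_0_iff)
    ultimately show False using M(1) by (fastforce simp: maximum_matching_iff_card)
  qed
  show ?thesis using inD notD isolated_verts_D_iff by blast
qed

text \<open>If Hall's condition for the neighbourhoods of the vertices failed, then a minimal violator would
  consist of isolated vertices, and a matching covering these would inject it into its
  neighbourhood. The representatives given by Hall's theorem form a permutation.\<close>

lemma permutation_along_arcs:
  assumes M: "matching G M" and cov: "isolated_verts (with_proj G \<restriction> D_set G) \<subseteq> covered M"
  shows "\<exists>\<sigma>. \<sigma> permutes pverts G \<and> (\<forall>v\<in>pverts G. (v, \<sigma> v) \<in> parcs G)"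
proof -
  let ?V = "pverts G"
  have finN: "finite (parcs G `` S)" for S
    using finite_subset[OF _ pair_finite_verts] by (auto dest: in_arcsD2)
  have hall: "card S \<le> card (parcs G `` S)" if "S \<subseteq> ?V" for S
  proof (rule ccontr)
    let ?viol = "\<lambda>T. T \<subseteq> ?V \<and> card (parcs G `` T) < card T"
    assume "\<not> card S \<le> card (parcs G `` S)"
    then have "?viol S" using that by simp
    then obtain T where T: "T \<subseteq> ?V" "card (parcs G `` T) < card T"
      and T_min: "\<And>T'. ?viol T' \<Longrightarrow> card T \<le> card T'"
      using ex_has_least_nat[of ?viol S card] by blast
    have finT: "finite T" using T(1) pair_finite_verts finite_subset by blast
    have "T \<subseteq> covered M"
      using minimal_violator_isolated[OF T] T_min T(1) psubset_card_mono[OF finT] cov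
      by (meson linorder_not_le order_trans psubset_imp_subset)
    then have "\<exists>u. {t, u} \<in> M" if "t \<in> T" for t
      using that by (meson covered_edge[OF M] subsetD)
    then obtain p where p: "\<And>t. t \<in> T \<Longrightarrow> {t, p t} \<in> M" by metis
    have arc: "(t, p t) \<in> parcs G" if "t \<in> T" for t
      using p[OF that] M by (auto simp: matching_def edge_iff_arc[symmetric])
    have "inj_on p T"
    proof (rule inj_onI)
      fix s t assume st: "s \<in> T" "t \<in> T" "p s = p t"
      then have "{s, p s} = {t, p t}"
        using matching_edge_unique[OF M p p, of s t "p s"] by auto
      then show "s = t" using st(3) by (auto simp: doubleton_eq_iff)
    qed
    then have "card T \<le> card (parcs G `` T)"
      by (rule card_inj_on_le) (use arc finN in auto)
    then show False using T(2) by simp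
  qed
  have "card J \<le> card (\<Union>v\<in>J. parcs G `` {v})" if "J \<subseteq> ?V" for J
  proof -
    have "(\<Union>v\<in>J. parcs G `` {v}) = parcs G `` J" by auto
    then show ?thesis using hall[OF that] by simp
  qed
  then obtain f where f: "inj_on f ?V" "\<forall>v\<in>?V. f v \<in> parcs G `` {v}"
    using hall_marriage[of ?V "\<lambda>v. parcs G `` {v}"] pair_finite_verts finN by auto
  define \<sigma> where "\<sigma> = (\<lambda>v. if v \<in> ?V then f v else v)"
  have "\<sigma> permutes ?V"
  proof (rule bij_imp_permutes)
    have inj: "inj_on \<sigma> ?V" using f(1) by (simp add: \<sigma>_def inj_on_def)
    have "\<sigma> ` ?V \<subseteq> ?V" using f(2) by (auto simp: \<sigma>_def dest: in_arcsD2)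
    then show "bij_betw \<sigma> ?V ?V"
      using inj endo_inj_surj[OF pair_finite_verts] by (simp add: bij_betw_def)
  qed (simp add: \<sigma>_def)
  then show ?thesis using f(2) by (auto simp: \<sigma>_def)
qed

end

theorem theorem4p1:
  fixes G :: "'a pair_pre_digraph" and n :: nat
  assumes "n \<ge> 2"
    and "pair_graph G"
    and "Digraph_Component.connected (with_proj G)"
    and "card (pverts G) = n"
  shows "permanental_nullity G = 0 \<longleftrightarrow>
    (\<exists>M. perfect_matching G M)
    \<or> isolated_verts (with_proj G \<restriction> D_set G) = {}
    \<or> (isolated_verts (with_proj G \<restriction> D_set G) \<noteq> {}
        \<and> (\<exists>M. maximum_matching G M \<and> isolated_verts (with_proj G \<restriction> D_set G) \<subseteq> covered M))"
proof -
  interpret pair_graph G by fact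
  let ?I = "isolated_verts (with_proj G \<restriction> D_set G)"
  have IV: "?I \<subseteq> pverts G" by (rule isolated_verts_D_subset)
  have "permanental_nullity G = 0 \<longleftrightarrow> (\<exists>M. maximum_matching G M \<and> ?I \<subseteq> covered M)"
    unfolding permanental_nullity_eq_0_iff
    using maximum_matching_covering_isolated permutation_along_arcs
    by (auto simp: maximum_matching_def)
  moreover have "\<exists>M. maximum_matching G M \<and> ?I \<subseteq> covered M" if "perfect_matching G M" for M
  proof -
    have "maximum_matching G M"
      using that card_mono[OF pair_finite_verts covered_subset_verts] covered_subset_verts
      by (auto simp: perfect_matching_def maximum_matching_def)
        (metis card_mono finite_subset pair_finite_verts subset_trans)
    then show ?thesis using that IV by (auto simp: perfect_matching_def)
  qed
  moreover have "\<exists>M. maximum_matching G M \<and> ?I \<subseteq> covered M" if "?I = {}"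
    using that ex_maximum_matching_maximising[of "\<lambda>_. 0" 0] by auto
  ultimately show ?thesis by blast
qed

end
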